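(* Let $(G_t)_{t\ge0}$ be a growing undirected graph generated by the generic preferential attachment model with sequences $(A_t)_{t\in\mathbb N}$, $(B_t)_{t\in\mathbb N}$ of $\mathbb N_0$-valued random variables (defined in the context). Let $\ell=\ell(n)$ and $u=u(n)$ be positive integers such that $\ell\le A_t+B_t\le u$ for every $t\in\mathbb N$. Then asymptotically almost surely (as $n\to\infty$) the diameter of $G_n$ is at most $4e(u/\ell)\log n+8eu+O(1)$.
   Context: Conventions: $\mathbb N=\{1,2,\dots\}$, $\mathbb N_0=\{0,1,2,\dots\}$; $\log$ is the natural logarithm and $e$ its base. Graphs are finite and may have loops and parallel edges. The diameter is the maximum distance between two vertices. The initial graph $G_0$ has size $O(1)$. "Asymptotically almost surely" means with probability tending to $1$ as $n\to\infty$. Generic preferential attachment model: $G_0$ is an arbitrary connected graph with at least one edge. At each time-step $t\in\mathbb N$, $G_t$ is obtained from $G_{t-1}$ by doing a vertex operation and an edge operation. Vertex operation: if $A_t>0$, a new vertex is born and $A_t$ edges are added as follows: an edge is sampled uniformly from $G_{t-1}$, one of its endpoints is chosen arbitrarily, and it is joined to the new vertex; for each of the other $A_t-1$ new edges, one endpoint is the new vertex and the other endpoint is arbitrary (it can be the new vertex as well). If $A_t=0$ the vertex operation does nothing. Edge operation: $B_t$ edges are sampled independently and uniformly from $G_{t-1}$, and an arbitrary endpoint of each sampled edge is chosen; then $B_t$ new edges are added, joining these chosen vertices to arbitrary vertices of $G_{t-1}$. No independence is required for $(A_t,B_t)_{t\in\mathbb N}$; in particular they can be correlated and depend on the past and the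 future of the process. *)

theory Defs
  imports "HOL-Probability.Probability" "HOL-Library.Uprod" "HOL-Library.Extended_Nat"
begin

section \<open>Undirected multigraphs\<close>

text \<open>
  Loops are the edges \<open>Upair x x\<close>. The edges form a list, so that parallel edges are
  distinct objects: an edge is identified by its position in the list.
\<close>

record 'v mgraph =
  verts :: "'v set"
  edges :: "'v uprod list"

definition wf_mgraph :: "'v mgraph \<Rightarrow> bool" where
  "wf_mgraph H \<longleftrightarrow> finite (verts H) \<and> (\<forall>e\<in>set (edges H). set_uprod e \<subseteq> verts H)"

definition adj :: "'v mgraph \<Rightarrow> 'v \<Rightarrow> 'v \<Rightarrow> bool" where
  "adj H x y \<longleftrightarrow> Upair x y \<in> set (edges H)"

definition walk :: "'v mgraph \<Rightarrow> nat \<Rightarrow> 'v \<Rightarrow> 'v \<Rightarrow> bool" where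
  "walk H k x y \<longleftrightarrow> (adj H ^^ k) x y"

definition connected_mgraph :: "'v mgraph \<Rightarrow> bool" where
  "connected_mgraph H \<longleftrightarrow>
     verts H \<noteq> {} \<and> (\<forall>x\<in>verts H. \<forall>y\<in>verts H. \<exists>k. walk H k x y)"

text \<open>The distance is \<open>\<infinity>\<close> if there is no walk.\<close>

definition graph_dist :: "'v mgraph \<Rightarrow> 'v \<Rightarrow> 'v \<Rightarrow> enat" where
  "graph_dist H x y = (INF k\<in>{k. walk H k x y}. enat k)"

definition graph_diameter :: "'v mgraph \<Rightarrow> enat" where
  "graph_diameter H = (SUP x\<in>verts H. SUP y\<in>verts H. graph_dist H x y)"

section \<open>The generic preferential attachment model\<close>

text \<open>
  In the following two definitions \<open>H\<close> is the graph before the step, \<open>W\<close> is the set of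
  vertices that are born, and \<open>es\<close> is the list of edges that are added. Sampled edges are
  given by their positions in \<open>edges H\<close>; the sample of a vertex operation is \<open>None\<close>
  if the operation does nothing. The existential quantifiers leave all choices that the model
  calls arbitrary unconstrained.
\<close>

definition vertex_operation ::
  "'v mgraph \<Rightarrow> nat \<Rightarrow> nat option \<Rightarrow> 'v set \<Rightarrow> 'v uprod list \<Rightarrow> bool" where
  "vertex_operation H a i W es \<longleftrightarrow>
     (if a = 0 then W = {} \<and> es = []
      else \<exists>v x fs. v \<notin> verts H \<and> W = {v} \<and>
             x \<in> set_uprod (edges H ! the i) \<and>
             es = Upair v x # fs \<and> length fs = a - 1 \<and>
             (\<forall>f\<in>set fs. \<exists>y\<in>insert v (verts H). f = Upair v y))"

definition edge_operation :: "'v mgraph \<Rightarrow> nat list \<Rightarrow> 'v uprod list \<Rightarrow> bool" where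
  "edge_operation H js es \<longleftrightarrow>
     list_all2 (\<lambda>j f. \<exists>x\<in>set_uprod (edges H ! j). \<exists>y\<in>verts H. f = Upair x y) js es"

definition gpa_step ::
  "'v mgraph \<Rightarrow> nat \<Rightarrow> nat option \<times> nat list \<Rightarrow> 'v mgraph \<Rightarrow> bool" where
  "gpa_step H a s H' \<longleftrightarrow>
     (\<exists>W es fs. vertex_operation H a (fst s) W es \<and> edge_operation H (snd s) fs \<and>
        H' = \<lparr>verts = verts H \<union> W, edges = edges H @ es @ fs\<rparr>)"

text \<open>
  The possible samples in a step from a graph with \<open>m\<close> edges, where \<open>a\<close> and \<open>b\<close> are the values
  of \<open>A\<^sub>t\<close> and \<open>B\<^sub>t\<close>. Being uniform on this product means that the sampled edges are uniform
  and independent.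
\<close>

definition sample_space :: "nat \<Rightarrow> nat \<Rightarrow> nat \<Rightarrow> (nat option \<times> nat list) set" where
  "sample_space m a b =
     (if a = 0 then {None} else Some ` {..<m}) \<times> {js. length js = b \<and> set js \<subseteq> {..<m}}"

text \<open>
  \<open>S t\<close> are the edges sampled at time \<open>t\<close>. The processes are indexed from time 1, except
  for \<open>G\<close>, so \<open>A 0\<close>, \<open>B 0\<close> and \<open>S 0\<close> are irrelevant. All graphs occurring in a process are
  finite, so that each \<open>G t\<close> has countably many values, and \<open>count_space UNIV\<close> is the natural
  \<open>\<sigma>\<close>-algebra.
\<close>

locale generic_preferential_attachment = prob_space M
  for M :: "'w measure" +
  fixes G0 :: "nat mgraph"
    and G :: "nat \<Rightarrow> 'w \<Rightarrow> nat mgraph"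
    and A B :: "nat \<Rightarrow> 'w \<Rightarrow> nat"
    and S :: "nat \<Rightarrow> 'w \<Rightarrow> nat option \<times> nat list"
  assumes measurable_G: "\<And>t. G t \<in> measurable M (count_space UNIV)"
    and measurable_A: "\<And>t. t \<ge> 1 \<Longrightarrow> A t \<in> measurable M (count_space UNIV)"
    and measurable_B: "\<And>t. t \<ge> 1 \<Longrightarrow> B t \<in> measurable M (count_space UNIV)"
    and measurable_S: "\<And>t. t \<ge> 1 \<Longrightarrow> S t \<in> measurable M (count_space UNIV)"
    and initial_wf: "wf_mgraph G0"
    and initial_connected: "connected_mgraph G0"
    and initial_edge: "edges G0 \<noteq> []"
    and initial: "\<And>\<omega>. \<omega> \<in> space M \<Longrightarrow> G 0 \<omega> = G0"
    and sample: "\<And>t \<omega>. t \<ge> 1 \<Longrightarrow> \<omega> \<in> space M \<Longrightarrow>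
      S t \<omega> \<in> sample_space (length (edges (G (t - 1) \<omega>))) (A t \<omega>) (B t \<omega>)"
    and step: "\<And>t \<omega>. t \<ge> 1 \<Longrightarrow> \<omega> \<in> space M \<Longrightarrow>
      gpa_step (G (t - 1) \<omega>) (A t \<omega>) (S t \<omega>) (G t \<omega>)"
    \<comment> \<open>Conditionally on any history before the sampling at time \<open>t\<close> (the atom of the history
        that contains \<open>\<omega>\<close>), the edges are sampled independently and uniformly. Nothing else
        is assumed about the joint distribution of the process.\<close>
    and uniform: "\<And>t \<omega> s past. \<lbrakk>t \<ge> 1; \<omega> \<in> space M;
      past = (\<lambda>\<omega>'. (\<forall>r<t. G r \<omega>' = G r \<omega>) \<and> (\<forall>r\<in>{1..<t}. S r \<omega>' = S r \<omega>) \<and>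
                   (\<forall>r\<in>{1..t}. A r \<omega>' = A r \<omega> \<and> B r \<omega>' = B r \<omega>));
      prob {\<omega>' \<in> space M. past \<omega>'} > 0;
      s \<in> sample_space (length (edges (G (t - 1) \<omega>))) (A t \<omega>) (B t \<omega>)\<rbrakk> \<Longrightarrow>
      cond_prob M (\<lambda>\<omega>'. S t \<omega>' = s) past =
        1 / card (sample_space (length (edges (G (t - 1) \<omega>))) (A t \<omega>) (B t \<omega>))"

end

theory Submission
  imports Defs "HOL-Real_Asymp.Real_Asymp"
begin

text \<open>
  Give an added edge the depth \<open>h + 1\<close> if \<open>h\<close> is the depth of the sampled edge from which it
  arose. A step moves at most two edges away from the sampled edge, so an endpoint of an
  edge of depth \<open>h\<close> is within \<open>2 h\<close> of the initial graph. Given the past, a step creates on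
  average at most \<open>u / (m + l t)\<close> edges of depth \<open>k + 1\<close> for every present edge of depth \<open>k\<close>,
  where \<open>m\<close> is the initial number of edges; hence the expected number of edges of depth \<open>k\<close>
  is at most \<open>m a ^ k / k!\<close> with \<open>a = u (2 + ln n / l)\<close>. This tends to 0 for
  \<open>k = \<lceil>e a\<rceil>\<close>, and depths occur without gaps, so that a.a.s. all depths are below \<open>e a + 1\<close>
  and the diameter is at most \<open>4 e a + O(1)\<close>.
\<close>

section \<open>Analytic estimates\<close>

text \<open>
  The polynomial gain over \<open>k! \<ge> (k / e) ^ k\<close> is essential: at \<open>k = e a\<close> the crude bound only
  gives \<open>a ^ k / k! \<le> 1\<close>.
\<close>

lemma ln_fact_lower_bound:
  assumes "k > 0"
  shows "real k * ln k - k + ln k / 4 \<le> ln (fact k)"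
  using assms
proof (induction k rule: nat_induct_non_zero)
  case 1
  then show ?case by simp
next
  case (Suc k)
  let ?x = "real k"
  have x: "?x > 0" using Suc by simp
  \<comment> \<open>The induction step amounts to (x + 1/4) (ln (x + 1) - ln x) <= 1. Convexity of
    1/x bounds the difference of logarithms by the trapezoid rule, and what remains reduces to x >=
    1/2. The weight 1/4 stays below the 1/2 of Stirling's formula, for which this bound would
    fail.\<close>
  have "ln (?x + 1) - ln ?x \<le> (inverse ?x + inverse (?x + 1)) / 2"
    using ln_inverse_approx_le[OF x zero_less_one] by simp
  then have "(?x + 1 / 4) * (ln (?x + 1) - ln ?x) \<le> (?x + 1 / 4) * ((inverse ?x + inverse (?x + 1)) / 2)"
    using x by (intro mult_left_mono) auto
  also have "\<dots> \<le> 1"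
    using x by (simp add: divide_simps, simp add: algebra_simps)
  finally have "(?x + 1 / 4) * ln (?x + 1) - 1 \<le> (?x + 1 / 4) * ln ?x"
    by (simp add: algebra_simps)
  moreover have "ln (fact (Suc k) :: real) = ln (?x + 1) + ln (fact k)"
    by (simp add: ln_mult add.commute)
  ultimately show ?case
    using Suc.IH by (simp add: algebra_simps)
qed

text \<open>The hypothesis says 1 + ln a <= ln k, so k ln a is absorbed by the main terms k ln k - k
  of ln k!. Only the polynomial gain survives: the right-hand side is k to the power -1/4.\<close>

lemma power_over_fact_le:
  fixes a :: real
  assumes "0 < a" "exp 1 * a \<le> real k"
  shows "a ^ k / fact k \<le> exp (- (ln k / 4))"
proof -
  have k: "k > 0"
    using assms by (metis exp_gt_zero gr0I mult_pos_pos not_le of_nat_0)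
  have "ln (exp 1 * a) \<le> ln k"
    using assms k by (subst ln_le_cancel_iff) auto
  then have "real k * (1 + ln a) \<le> real k * ln k"
    using assms by (intro mult_left_mono) (auto simp: ln_mult)
  then have "real k * ln a - ln (fact k) \<le> - (ln k / 4)"
    using ln_fact_lower_bound[OF k] by (simp add: algebra_simps)
  then have "exp (real k * ln a - ln (fact k)) \<le> exp (- (ln k / 4))"
    by simp
  moreover have "exp (real k * ln a - ln (fact k)) = a ^ k / fact k"
    using assms(1) by (simp add: exp_diff exp_of_nat_mult)
  ultimately show ?thesis by simp
qed

text \<open>These are the first two terms of the binomial expansion; the others are
  nonnegative.\<close>

lemma power_Suc_add_ge:
  fixes s p :: real
  assumes "s \<ge> 0" "p \<ge> 0"
  shows "s ^ Suc k + real (Suc k) * p * s ^ k \<le> (s + p) ^ Suc k"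
proof (induction k)
  case (Suc k)
  have "s ^ Suc (Suc k) + real (Suc (Suc k)) * p * s ^ Suc k
      \<le> (s + p) * (s ^ Suc k + real (Suc k) * p * s ^ k)"
    using assms by (simp add: algebra_simps)
  also have "\<dots> \<le> (s + p) * (s + p) ^ Suc k"
    using assms Suc by (intro mult_left_mono) auto
  finally show ?case by simp
qed simp

text \<open>With s the sum of the sampling factors so far and p the next one, this makes s^k / k! a
  supersolution of the recursion for the expected numbers of edges of depth k.\<close>

lemma power_over_fact_add:
  fixes s p :: real
  assumes "s \<ge> 0" "p \<ge> 0"
  shows "s ^ Suc k / fact (Suc k) + p * (s ^ k / fact k) \<le> (s + p) ^ Suc k / fact (Suc k)"
proof -
  have "s ^ Suc k / fact (Suc k) + p * (s ^ k / fact k)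
      = (s ^ Suc k + real (Suc k) * p * s ^ k) / fact (Suc k)"
    by (simp add: field_simps del: of_nat_Suc)
  also have "\<dots> \<le> (s + p) ^ Suc k / fact (Suc k)"
    using power_Suc_add_ge[OF assms] by (intro divide_right_mono) auto
  finally show ?thesis .
qed

text \<open>The first term is at most 1, the others are dominated by 1 / (l t), and the harmonic sum
  is at most 1 + ln n; finally 1 / l <= 1. Multiplied by 4 e u, the constant 2 becomes the summand 8
  e u of the theorem.\<close>

lemma sum_inverse_arith_progression_le:
  fixes m l n :: nat
  assumes "m > 0" "l > 0" "n > 0"
  shows "(\<Sum>t<n. 1 / (real m + real l * real t)) \<le> 2 + ln n / l"
proof -
  obtain n' where n: "n = Suc n'" using assms(3) gr0_implies_Suc by blast
  have "1 / real m \<le> 1" using assms by (simp add: field_simps)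
  moreover have "(\<Sum>t<n'. 1 / (real m + real l * real (Suc t))) \<le> (\<Sum>t<n'. inverse (real (Suc t)) / real l)"
  proof (intro sum_mono)
    fix t
    have "1 / (real m + real l * real (Suc t)) \<le> 1 / (real l * real (Suc t))"
      using assms by (intro divide_left_mono mult_pos_pos add_pos_pos) auto
    then show "1 / (real m + real l * real (Suc t)) \<le> inverse (real (Suc t)) / real l"
      by (simp add: inverse_eq_divide mult.commute)
  qed
  ultimately have "(\<Sum>t<n. 1 / (real m + real l * real t)) \<le> 1 + (\<Sum>t<n'. inverse (real (Suc t)) / real l)"
    unfolding n sum.lessThan_Suc_shift by simp
  also have "(\<Sum>t<n'. inverse (real (Suc t)) / real l) = harm n' / real l"
    by (simp add: harm_altdef flip: sum_divide_distrib)
  also have "harm n' \<le> (harm n :: real)"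
    unfolding n harm_Suc by simp
  also have "harm n \<le> 1 + ln (real n)"
    using euler_mascheroni_sequence_decreasing[of 1 n] assms by (simp add: harm_def)
  also have "1 + (1 + ln (real n)) / real l = 1 + 1 / real l + ln n / l"
    by (simp add: add_divide_distrib)
  also have "\<dots> \<le> 2 + ln n / l"
    using assms by simp
  finally show ?thesis using assms by (simp add: divide_right_mono)
qed

section \<open>Walks and distances\<close>

lemma Upair_commute: "Upair x y = Upair y x"
  by simp

lemma adj_commute: "adj H x y \<Longrightarrow> adj H y x"
  unfolding adj_def by (subst Upair_commute)

lemma walk_0 [simp]: "walk H 0 x x"
  by (simp add: walk_def)

lemma walk_trans: "walk H i x y \<Longrightarrow> walk H j y z \<Longrightarrow> walk H (i + j) x z"
  unfolding walk_def by (rule relpowp_trans)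

lemma adj_imp_walk: "adj H x y \<Longrightarrow> walk H 1 x y"
  by (simp add: walk_def relcompp_apply)

lemma walk_commute: "walk H k x y \<Longrightarrow> walk H k y x"
proof (induction k arbitrary: y)
  case (Suc k)
  then obtain z where "walk H k x z" "adj H z y"
    by (auto simp: walk_def)
  then have "walk H (1 + k) y x"
    using Suc.IH by (intro walk_trans[OF adj_imp_walk]) (auto intro: adj_commute)
  then show ?case by simp
qed (simp add: walk_def)

lemma walk_mono:
  assumes "set (edges H) \<subseteq> set (edges H')" "walk H k x y"
  shows "walk H' k x y"
proof -
  have "adj H \<le> adj H'"
    using assms(1) by (auto simp: adj_def)
  then show ?thesis
    using assms(2) relpowp_mono[of "adj H" "adj H'" k x y] unfolding walk_def by auto
qed

lemma adj_in_verts: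
  assumes "wf_mgraph H" "adj H x y"
  shows "x \<in> verts H" "y \<in> verts H"
  using assms unfolding wf_mgraph_def adj_def by force+

text \<open>A shortest walk uses at most as many steps as the adjacency relation has pairs. The
  crude bound suffices, since it is applied only to the initial graph, whose size is O(1).\<close>

lemma connected_short_walk:
  assumes "wf_mgraph H" "connected_mgraph H" "x \<in> verts H" "y \<in> verts H"
  obtains k where "walk H k x y" "k \<le> (card (verts H))\<^sup>2"
proof -
  define R where "R = {(x, y). adj H x y}"
  have sub: "R \<subseteq> verts H \<times> verts H"
    using adj_in_verts[OF assms(1)] by (auto simp: R_def)
  have fin: "finite (verts H)" using assms(1) by (simp add: wf_mgraph_def)
  have "finite R" using sub fin finite_subset by blast
  have card: "card R \<le> (card (verts H))\<^sup>2"
    using card_mono[OF _ sub] fin by (simp add: card_cartesian_product power2_eq_square)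
  have walk_iff: "walk H k a b \<longleftrightarrow> (a, b) \<in> R ^^ k" for k a b
    using relpowp_relpow_eq[of k R] by (simp add: R_def walk_def fun_eq_iff)
  obtain k where "(x, y) \<in> R ^^ k"
    using assms unfolding connected_mgraph_def walk_iff by blast
  then obtain k' where "(x, y) \<in> R ^^ k'" "k' \<le> card R"
    using relpow_finite_bounded[OF \<open>finite R\<close>, of k] by blast
  then show thesis using that card walk_iff by (meson order_trans)
qed

lemma graph_diameter_le:
  assumes "\<And>x y. x \<in> verts H \<Longrightarrow> y \<in> verts H \<Longrightarrow> \<exists>k\<le>d. walk H k x y"
  shows "graph_diameter H \<le> enat d"
  unfolding graph_diameter_def
proof (intro SUP_least)
  fix x y assume "x \<in> verts H" "y \<in> verts H"
  then obtain k where k: "k \<le> d" "walk H k x y" using assms by blast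
  then have "graph_dist H x y \<le> enat k"
    unfolding graph_dist_def by (intro INF_lower) auto
  also have "\<dots> \<le> enat d" using k by simp
  finally show "graph_dist H x y \<le> enat d" .
qed

section \<open>Sampling depths\<close>

text \<open>All edges of a vertex operation count as descendants of its one sampled edge.\<close>

definition depth_step :: "nat list \<Rightarrow> nat \<Rightarrow> nat option \<times> nat list \<Rightarrow> nat list" where
  "depth_step hs a s =
     hs @ replicate a (Suc (hs ! the (fst s))) @ map (\<lambda>j. Suc (hs ! j)) (snd s)"

text \<open>Here \<open>hs ! i\<close> is read as the depth of the edge at position
  \<open>i\<close>; positions keep parallel edges apart. \<open>V\<close> will be the vertex set of
  the initial graph.\<close>

definition edges_within :: "'v set \<Rightarrow> 'v mgraph \<Rightarrow> nat list \<Rightarrow> bool" where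
  "edges_within V H hs \<longleftrightarrow> length hs = length (edges H) \<and>
     (\<forall>i<length hs. \<forall>v\<in>set_uprod (edges H ! i). \<exists>x\<in>V. \<exists>k\<le>2 * hs ! i. walk H k v x)"

lemma edges_withinD:
  assumes "edges_within V H hs" "i < length hs" "v \<in> set_uprod (edges H ! i)"
  obtains x k where "x \<in> V" "k \<le> 2 * hs ! i" "walk H k v x"
  using assms unfolding edges_within_def by blast

lemma walk_Cons:
  assumes "adj H v w" "walk H k w x"
  shows "walk H (Suc k) v x"
  using walk_trans[OF adj_imp_walk[OF assms(1)] assms(2)] by simp

text \<open>Old walks survive because edges are only added. If the sampled edge has depth h, its
  chosen endpoint is within 2 h of \<open>V\<close>. A new vertex is adjacent to that endpoint,
  hence within 2 h + 1, and since every edge of the vertex operation contains the new vertex, its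
  other end is within 2 h + 2. In the edge operation the second endpoint is already within 2 h +
  1.\<close>

lemma edges_within_step:
  assumes within: "edges_within V H hs"
    and s: "s \<in> sample_space (length (edges H)) a b"
    and step: "gpa_step H a s H'"
  shows "edges_within V H' (depth_step hs a s)"
proof -
  let ?m = "length hs"
  have m: "length (edges H) = ?m" using within by (simp add: edges_within_def)
  obtain W es fs where W: "vertex_operation H a (fst s) W es"
    and fs: "edge_operation H (snd s) fs"
    and H': "H' = \<lparr>verts = verts H \<union> W, edges = edges H @ es @ fs\<rparr>"
    using step unfolding gpa_step_def by blast
  have mono: "walk H k x y \<Longrightarrow> walk H' k x y" for k x y
    by (rule walk_mono[of H]) (auto simp: H')
  have len_es: "length es = a"
    using W by (auto simp: vertex_operation_def split: if_splits)
  have len_fs: "length fs = length (snd s)"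
    using fs by (auto simp: edge_operation_def list_all2_lengthD)
  have adjI: "adj H' v w" if "Upair v w \<in> set (es @ fs)" for v w
    using that by (auto simp: adj_def H')
  define near where "near d v \<longleftrightarrow> (\<exists>x\<in>V. \<exists>k\<le>d. walk H' k v x)" for d :: nat and v
  have near_mono: "near d v \<Longrightarrow> d \<le> d' \<Longrightarrow> near d' v" for d d' v
    unfolding near_def by (meson order_trans)
  have near_adj: "near (Suc d) v" if "adj H' v w" "near d w" for d v w
    using that walk_Cons[of H' v w] unfolding near_def by (meson Suc_le_mono)
  have near_old: "near (2 * hs ! i) v" if "i < ?m" "v \<in> set_uprod (edges H ! i)" for i v
    using edges_withinD[OF within that] mono unfolding near_def by metis
  have es_near: "near (2 * Suc (hs ! the (fst s))) v" if "e \<in> set es" "v \<in> set_uprod e" for e v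
  proof -
    have "a \<noteq> 0" using that W by (auto simp: vertex_operation_def split: if_splits)
    then obtain i where i: "fst s = Some i" "i < ?m"
      using s m by (auto simp: sample_space_def)
    obtain w x gs where x: "x \<in> set_uprod (edges H ! i)" "es = Upair w x # gs"
      and gs: "\<forall>f\<in>set gs. \<exists>y\<in>insert w (verts H). f = Upair w y"
      using W \<open>a \<noteq> 0\<close> i unfolding vertex_operation_def by auto
    have nx: "near (2 * hs ! i) x" using near_old[OF i(2) x(1)] .
    have nw: "near (Suc (2 * hs ! i)) w"
      using near_adj[OF adjI nx, of w] x(2) by simp
    have "\<exists>y. e = Upair w y"
      using that(1) x(2) gs by auto
    then obtain y where y: "e = Upair w y" ..
    have "adj H' y w"
      using that(1) y by (intro adj_commute[OF adjI]) auto
    then have "near (Suc (Suc (2 * hs ! i))) y" using nw near_adj by blast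
    moreover have "near (Suc (Suc (2 * hs ! i))) w" using near_mono[OF nw] by simp
    ultimately show ?thesis
      using that(2) y i(1) by auto
  qed
  have fs_near: "near (2 * Suc (hs ! (snd s ! i))) v"
    if "i < length fs" "v \<in> set_uprod (fs ! i)" for i v
  proof -
    have "snd s ! i \<in> set (snd s)" using that(1) len_fs by simp
    moreover have "set (snd s) \<subseteq> {..<?m}" using s m by (auto simp: sample_space_def)
    ultimately have i: "snd s ! i < ?m" by blast
    have "\<exists>x\<in>set_uprod (edges H ! (snd s ! i)). \<exists>y\<in>verts H. fs ! i = Upair x y"
      using fs that(1) len_fs unfolding edge_operation_def list_all2_conv_all_nth by simp
    then obtain x y where x: "x \<in> set_uprod (edges H ! (snd s ! i))" "fs ! i = Upair x y"
      by blast
    have nx: "near (2 * hs ! (snd s ! i)) x" using near_old[OF i x(1)] .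
    have "Upair x y \<in> set fs"
      using nth_mem[OF that(1)] unfolding x(2) .
    then have "adj H' y x"
      by (intro adj_commute[OF adjI]) simp
    then have "near (Suc (2 * hs ! (snd s ! i))) y" using nx near_adj by blast
    then have "near (2 * Suc (hs ! (snd s ! i))) y" by (rule near_mono) simp
    moreover have "near (2 * Suc (hs ! (snd s ! i))) x" by (rule near_mono[OF nx]) simp
    ultimately show ?thesis
      using that(2) x(2) by auto
  qed
  have "near (2 * depth_step hs a s ! i) v"
    if "i < length (depth_step hs a s)" "v \<in> set_uprod (edges H' ! i)" for i v
  proof -
    consider "i < ?m" | "?m \<le> i" "i < ?m + a" | "?m + a \<le> i" by linarith
    then show ?thesis
    proof cases
      case 1
      then show ?thesis
        using near_old[of i v] that m by (simp add: H' depth_step_def nth_append)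
    next
      case 2
      then have es_i: "edges H' ! i = es ! (i - ?m)" "i - ?m < length es"
        using m len_es by (auto simp: H' nth_append)
      have "i - ?m < a" using 2 by linarith
      then have "depth_step hs a s ! i = Suc (hs ! the (fst s))"
        using 2 by (simp add: depth_step_def nth_append)
      then show ?thesis using es_near[of "es ! (i - ?m)" v] that(2) nth_mem[OF es_i(2)] es_i(1) by simp
    next
      case 3
      have len: "i - ?m - a < length fs"
        using that(1) 3 len_fs by (simp add: depth_step_def)
      have nlt: "\<not> i - ?m < a" using 3 by linarith
      have "edges H' ! i = fs ! (i - ?m - a)"
        using 3 nlt m len_es by (simp add: H' nth_append)
      moreover have "depth_step hs a s ! i = Suc (hs ! (snd s ! (i - ?m - a)))"
        using 3 nlt len len_fs by (simp add: depth_step_def nth_append)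
      ultimately show ?thesis using fs_near[OF len] that(2) by simp
    qed
  qed
  moreover have "length (depth_step hs a s) = length (edges H')"
    using m len_es len_fs by (simp add: H' depth_step_def)
  ultimately show ?thesis
    unfolding edges_within_def near_def by blast
qed

definition downward_closed :: "nat set \<Rightarrow> bool" where
  "downward_closed X \<longleftrightarrow> (\<forall>x\<in>X. {..x} \<subseteq> X)"

text \<open>Every new depth is the successor of a depth already present, so no gap can open. Thus
  the absence of one single depth bounds all depths, and one first-moment estimate will do.\<close>

lemma downward_closed_depth_step:
  assumes "downward_closed (set hs)" "s \<in> sample_space (length hs) a b"
  shows "downward_closed (set (depth_step hs a s))"
proof -
  have Suc_in: "{..Suc (hs ! i)} \<subseteq> insert (Suc (hs ! i)) (set hs)" if "i < length hs" for i
    using assms(1) that nth_mem[OF that] by (auto simp: downward_closed_def atMost_Suc)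
  have js: "\<And>j. j \<in> set (snd s) \<Longrightarrow> j < length hs"
    and i: "a \<noteq> 0 \<Longrightarrow> the (fst s) < length hs"
    using assms(2) by (auto simp: sample_space_def)
  show ?thesis
    unfolding downward_closed_def
  proof
    fix x assume "x \<in> set (depth_step hs a s)"
    then consider "x \<in> set hs" | "a \<noteq> 0" "x = Suc (hs ! the (fst s))"
      | j where "j \<in> set (snd s)" "x = Suc (hs ! j)"
      by (auto simp: depth_step_def split: if_splits)
    then show "{..x} \<subseteq> set (depth_step hs a s)"
    proof cases
      case 1
      then show ?thesis using assms(1) by (auto simp: downward_closed_def depth_step_def)
    next
      case 2
      then show ?thesis using Suc_in[OF i] by (auto simp: depth_step_def)
    next
      case 3
      then show ?thesis using Suc_in[OF js] by (auto simp: depth_step_def)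
    qed
  qed
qed

section \<open>Counting over the samples of one step\<close>

text \<open>Linearity: in a uniform list each of the b entries is uniform on the m positions. The
  factor m on the left avoids the exponent b - 1 and makes the identity hold for b = 0 and m = 0 as
  well.\<close>

lemma sum_lists_sum_list:
  fixes f :: "nat \<Rightarrow> real"
  shows "real m * (\<Sum>js\<in>{js. length js = b \<and> set js \<subseteq> {..<m}}. \<Sum>j\<leftarrow>js. f j)
     = real b * real m ^ b * (\<Sum>j<m. f j)"
proof (induction b)
  case 0
  have "{js :: nat list. js = [] \<and> set js \<subseteq> {..<m}} = {[]}" by auto
  then show ?case by simp
next
  case (Suc b)
  define L where "L b = {js. length js = b \<and> set js \<subseteq> {..<m}}" for b
  have eq: "L c = {js. set js \<subseteq> {..<m} \<and> length js = c}" for c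
    by (auto simp: L_def)
  have card: "card (L c) = m ^ c" for c
    unfolding eq by (simp add: card_lists_length_eq)
  have L: "L (Suc b) = (\<lambda>(xs, n). n # xs) ` (L b \<times> {..<m})"
    unfolding eq lists_length_Suc_eq ..
  have "(\<Sum>js\<in>L (Suc b). \<Sum>j\<leftarrow>js. f j) = (\<Sum>(xs, n)\<in>L b \<times> {..<m}. f n + (\<Sum>j\<leftarrow>xs. f j))"
    unfolding L by (subst sum.reindex) (auto simp: inj_on_def case_prod_unfold intro!: sum.cong)
  also have "\<dots> = real m ^ b * (\<Sum>j<m. f j) + real m * (\<Sum>js\<in>L b. \<Sum>j\<leftarrow>js. f j)"
    by (simp add: sum.cartesian_product[symmetric] sum.distrib card sum_distrib_left)
  finally show ?case
    using Suc unfolding L_def[symmetric] by (simp add: algebra_simps)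
qed

lemma sum_of_bool_nth_eq_count_list:
  "(\<Sum>i<length hs. of_bool (hs ! i = k)) = real (count_list hs k)"
proof -
  have "(\<Sum>i<length hs. of_bool (hs ! i = k)) = real (card {i. i < length hs \<and> k = hs ! i})"
    by (subst sum_of_bool_eq) (auto intro!: arg_cong[where f = card])
  then show ?thesis
    by (simp add: count_list_eq_length_filter length_filter_conv_card)
qed

lemma count_list_depth_step:
  "count_list (depth_step hs a s) (Suc k) = count_list hs (Suc k)
     + a * of_bool (hs ! the (fst s) = k) + (\<Sum>j\<leftarrow>snd s. of_bool (hs ! j = k))"
proof -
  have "count_list (replicate a x) y = a * of_bool (x = y)" for a and x y :: nat
    by (induction a) auto
  moreover have "count_list (map (\<lambda>j. Suc (hs ! j)) js) (Suc k) = (\<Sum>j\<leftarrow>js. of_bool (hs ! j = k))" for js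
    by (induction js) auto
  ultimately show ?thesis
    by (simp add: depth_step_def)
qed

lemma count_list_depth_step_0: "count_list (depth_step hs a s) 0 = count_list hs 0"
proof -
  have "count_list (replicate a (Suc x)) 0 = 0" for a x
    by (induction a) auto
  moreover have "count_list (map (\<lambda>j. Suc (hs ! j)) js) 0 = 0" for js
    by (induction js) auto
  ultimately show ?thesis
    by (simp add: depth_step_def)
qed

lemma finite_sample_space: "finite (sample_space m a b)"
proof -
  have "{js :: nat list. length js = b \<and> set js \<subseteq> {..<m}} = {js. set js \<subseteq> {..<m} \<and> length js = b}"
    by auto
  then show ?thesis by (simp add: sample_space_def finite_lists_length_eq)
qed

text \<open>This is the mean over a uniform sample. Each of the a + b new edges has a uniformly
  distributed parent, which has depth k with probability \<open>count_list hs k / m\<close>. The a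
  edges of the vertex operation share one parent, but expectations do not see this
  dependence.\<close>

lemma sum_count_list_depth_step:
  assumes "hs \<noteq> []"
  defines "m \<equiv> length hs"
  shows "(\<Sum>s\<in>sample_space m a b. real (count_list (depth_step hs a s) (Suc k)))
     = card (sample_space m a b) *
        (real (count_list hs (Suc k)) + real (a + b) / real m * real (count_list hs k))"
proof -
  define V where "V = (if a = 0 then {None} else Some ` {..<m})"
  define L where "L = {js. length js = b \<and> set js \<subseteq> {..<m}}"
  have eq: "L = {js. set js \<subseteq> {..<m} \<and> length js = b}"
    by (auto simp: L_def)
  have cardL: "card L = m ^ b"
    unfolding eq by (simp add: card_lists_length_eq)
  have m: "m > 0" using assms by simp
  define g :: "nat \<Rightarrow> real" where "g j = of_bool (hs ! j = k)" for j
  have sum_g: "(\<Sum>j<m. g j) = real (count_list hs k)"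
    unfolding g_def m_def by (rule sum_of_bool_nth_eq_count_list)
  \<comment> \<open>If \<open>a = 0\<close>, then \<open>V\<close> is \<open>{None}\<close> and
    \<open>the None\<close> is unspecified, but the factor \<open>a\<close> annihilates both
    sides.\<close>
  have sumV: "real m * (\<Sum>i\<in>V. real a * g (the i)) = real (card V) * real a * real (count_list hs k)"
    by (simp add: V_def sum.reindex sum_g card_image flip: sum_distrib_left)
  have sumL: "real m * (\<Sum>js\<in>L. \<Sum>j\<leftarrow>js. g j) = real b * real (card L) * real (count_list hs k)"
    using sum_lists_sum_list[where f = g and m = m and b = b] unfolding L_def[symmetric] cardL sum_g by simp
  have real_sum_list: "real (\<Sum>j\<leftarrow>js. of_bool (hs ! j = k)) = (\<Sum>j\<leftarrow>js. g j)" for js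
    by (induction js) (auto simp: g_def)
  have "real m * (\<Sum>s\<in>sample_space m a b. real (count_list (depth_step hs a s) (Suc k)))
     = real m * (\<Sum>(i, js)\<in>V \<times> L. real (count_list hs (Suc k)) + real a * g (the i) + (\<Sum>j\<leftarrow>js. g j))"
    unfolding sample_space_def V_def[symmetric] L_def[symmetric] count_list_depth_step
    by (intro arg_cong2[where f = "(*)"] sum.cong refl) (auto simp: real_sum_list g_def[of "the _"])
  also have "\<dots> = real m * (real (card V) * real (card L) * real (count_list hs (Suc k)))
      + real (card L) * (real m * (\<Sum>i\<in>V. real a * g (the i)))
      + real (card V) * (real m * (\<Sum>js\<in>L. \<Sum>j\<leftarrow>js. g j))"
    by (simp add: sum.cartesian_product[symmetric] sum.distrib sum_distrib_left algebra_simps)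
  also have "\<dots> = real m * (card (sample_space m a b) *
        (real (count_list hs (Suc k)) + real (a + b) / real m * real (count_list hs k)))"
    unfolding sumV sumL sample_space_def V_def[symmetric] L_def[symmetric]
    using m by (simp add: card_cartesian_product field_simps)
  finally show ?thesis using m by simp
qed

section \<open>Expected numbers of edges of given depth\<close>

text \<open>The level sets of \<open>Y\<close> form a countable measurable partition, so each
  integral is the sum of its parts over the atoms. Comparing atom by atom takes the place of
  conditional expectations.\<close>

lemma nn_integral_mono_atoms:
  assumes "countable (Y ` space M)"
    and [measurable]: "\<And>\<omega>. \<omega> \<in> space M \<Longrightarrow> {\<omega>' \<in> space M. Y \<omega>' = Y \<omega>} \<in> sets M"
    and [measurable]: "f \<in> borel_measurable M" "g \<in> borel_measurable M"
    and le: "\<And>\<omega>. \<omega> \<in> space M \<Longrightarrow>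
      (\<integral>\<^sup>+\<omega>'. f \<omega>' * indicator {\<omega>' \<in> space M. Y \<omega>' = Y \<omega>} \<omega>' \<partial>M)
      \<le> (\<integral>\<^sup>+\<omega>'. g \<omega>' * indicator {\<omega>' \<in> space M. Y \<omega>' = Y \<omega>} \<omega>' \<partial>M)"
  shows "(\<integral>\<^sup>+\<omega>. f \<omega> \<partial>M) \<le> (\<integral>\<^sup>+\<omega>. g \<omega> \<partial>M)"
proof -
  \<comment> \<open>Insert the sum over all atoms of their indicators, which equals 1, and exchange
    the countable sum with the integral.\<close>
  have split: "(\<integral>\<^sup>+\<omega>. h \<omega> \<partial>M) = (\<integral>\<^sup>+y. \<integral>\<^sup>+\<omega>. h \<omega> * indicator {\<omega>' \<in> space M. Y \<omega>' = y} \<omega> \<partial>M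
      \<partial>count_space (Y ` space M))" if [measurable]: "h \<in> borel_measurable M" for h :: "_ \<Rightarrow> ennreal"
  proof -
    have "(\<integral>\<^sup>+y. h \<omega> * indicator {\<omega>' \<in> space M. Y \<omega>' = y} \<omega> \<partial>count_space (Y ` space M)) = h \<omega>"
      if "\<omega> \<in> space M" for \<omega>
    proof -
      have "(\<integral>\<^sup>+y. h \<omega> * indicator {\<omega>' \<in> space M. Y \<omega>' = y} \<omega> \<partial>count_space (Y ` space M))
        = (\<integral>\<^sup>+y. h \<omega> * indicator {Y \<omega>} y \<partial>count_space (Y ` space M))"
        using that by (intro nn_integral_cong) (auto split: split_indicator)
      also have "\<dots> = h \<omega>"
        using that by (simp add: nn_integral_cmult_indicator)
      finally show ?thesis .
    qed
    then have "(\<integral>\<^sup>+\<omega>. h \<omega> \<partial>M) = (\<integral>\<^sup>+\<omega>. \<integral>\<^sup>+y. h \<omega> * indicator {\<omega>' \<in> space M. Y \<omega>' = y} \<omega>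
        \<partial>count_space (Y ` space M) \<partial>M)"
      by (intro nn_integral_cong) simp
    also have "\<dots> = (\<integral>\<^sup>+y. \<integral>\<^sup>+\<omega>. h \<omega> * indicator {\<omega>' \<in> space M. Y \<omega>' = y} \<omega> \<partial>M
        \<partial>count_space (Y ` space M))"
      using assms(1) by (rule nn_integral_count_space_nn_integral) auto
    finally show ?thesis .
  qed
  show ?thesis
    unfolding split[OF assms(3)] split[OF assms(4)]
    by (rule nn_integral_mono) (auto intro: le)
qed

text \<open>The whole type is uncountable because vertex sets may be infinite. Restricted to finite
  vertex sets it is countable, which gives a history only countably many values.\<close>

lemma countable_finite_mgraphs: "countable {H :: nat mgraph. finite (verts H)}"
proof -
  have "countable (UNIV :: nat uprod set)"
  proof -
    have "(UNIV :: nat uprod set) = range (case_prod Upair)"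
      by (auto simp: image_def intro: uprod_exhaust)
    then show ?thesis by (metis countable_image countableI_type)
  qed
  then have "countable (lists (UNIV :: nat uprod set))" by (rule countable_lists)
  then have "countable (Collect finite \<times> lists (UNIV :: nat uprod set) :: (nat set \<times> _) set)"
    by (intro countable_SIGMA countable_Collect_finite)
  moreover have "{H :: nat mgraph. finite (verts H)}
      \<subseteq> (\<lambda>(V, es). \<lparr>verts = V, edges = es\<rparr>) ` (Collect finite \<times> lists UNIV)"
  proof
    fix H :: "nat mgraph" assume "H \<in> {H. finite (verts H)}"
    then show "H \<in> (\<lambda>(V, es). \<lparr>verts = V, edges = es\<rparr>) ` (Collect finite \<times> lists UNIV)"
      by (intro image_eqI[of _ _ "(verts H, edges H)"]) auto
  qed
  ultimately show ?thesis
    by (meson countable_image countable_subset)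
qed

context generic_preferential_attachment
begin

section \<open>Depths along the process and their relation to the diameter\<close>

primrec depths :: "nat \<Rightarrow> 'w \<Rightarrow> nat list" where
  "depths 0 \<omega> = replicate (length (edges G0)) 0"
| "depths (Suc t) \<omega> = depth_step (depths t \<omega>) (A (Suc t) \<omega>) (S (Suc t) \<omega>)"

lemma edges_within_depths:
  assumes "\<omega> \<in> space M"
  shows "edges_within (verts G0) (G t \<omega>) (depths t \<omega>)"
proof (induction t)
  case 0
  have "v \<in> verts G0" if "i < length (edges G0)" "v \<in> set_uprod (edges G0 ! i)" for i v
    using initial_wf that nth_mem[OF that(1)] unfolding wf_mgraph_def by blast
  then have "\<exists>x\<in>verts G0. walk G0 0 v x"
    if "i < length (edges G0)" "v \<in> set_uprod (edges G0 ! i)" for i v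
    using that by (meson walk_0)
  then show ?case
    by (simp add: edges_within_def initial[OF assms])
next
  case (Suc t)
  then show ?case
    using edges_within_step[OF Suc] sample[of "Suc t", OF _ assms] step[of "Suc t", OF _ assms] by simp
qed

lemma length_depths:
  assumes "\<omega> \<in> space M"
  shows "length (depths t \<omega>) = length (edges (G t \<omega>))"
  using edges_within_depths[OF assms] by (simp add: edges_within_def)

lemma length_depths_Suc:
  assumes "\<omega> \<in> space M"
  shows "length (depths (Suc t) \<omega>) = length (depths t \<omega>) + A (Suc t) \<omega> + B (Suc t) \<omega>"
  using sample[of "Suc t", OF _ assms] by (auto simp: depth_step_def sample_space_def)

text \<open>This lower bound on the number of edges is the source of the denominators m + l t of the
  sampling factors.\<close>

lemma length_depths_ge:
  assumes "\<omega> \<in> space M" "\<And>r. r \<ge> 1 \<Longrightarrow> l \<le> A r \<omega> + B r \<omega>"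
  shows "length (edges G0) + l * t \<le> length (depths t \<omega>)"
proof (induction t)
  case (Suc t)
  then show ?case using assms(2)[of "Suc t"] length_depths_Suc[OF assms(1), of t] by simp
qed simp

lemma downward_closed_depths:
  assumes "\<omega> \<in> space M"
  shows "downward_closed (set (depths t \<omega>))"
proof (induction t)
  case 0
  then show ?case by (auto simp: downward_closed_def split: if_splits)
next
  case (Suc t)
  then show ?case
    using downward_closed_depth_step sample[of "Suc t", OF _ assms] length_depths[OF assms]
    by simp
qed

text \<open>The invariant on depths speaks only of endpoints of edges. It reaches every later vertex
  because a vertex is born together with at least one edge.\<close>

lemma vertex_initial_or_in_edge:
  assumes "\<omega> \<in> space M" "v \<in> verts (G t \<omega>)"
  shows "v \<in> verts G0 \<or> (\<exists>e\<in>set (edges (G t \<omega>)). v \<in> set_uprod e)"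
  using assms(2)
proof (induction t)
  case 0
  then show ?case using initial[OF assms(1)] by simp
next
  case (Suc t)
  obtain W es fs where "vertex_operation (G t \<omega>) (A (Suc t) \<omega>) (fst (S (Suc t) \<omega>)) W es"
    and G: "G (Suc t) \<omega> = \<lparr>verts = verts (G t \<omega>) \<union> W, edges = edges (G t \<omega>) @ es @ fs\<rparr>"
    using step[of "Suc t", OF _ assms(1)] unfolding gpa_step_def by auto
  then have "w \<in> W \<Longrightarrow> \<exists>e\<in>set es. w \<in> set_uprod e" for w
    by (auto simp: vertex_operation_def split: if_splits)
  then show ?case using Suc unfolding G by auto
qed

lemma finite_verts:
  assumes "\<omega> \<in> space M"
  shows "finite (verts (G t \<omega>))"
proof -
  have "verts (G t \<omega>) \<subseteq> verts G0 \<union> (\<Union>e\<in>set (edges (G t \<omega>)). set_uprod e)"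
    using vertex_initial_or_in_edge[OF assms] by blast
  moreover have "finite (verts G0)" using initial_wf by (simp add: wf_mgraph_def)
  ultimately show ?thesis using finite_subset by fastforce
qed

text \<open>All depths are at most k - 1 because they have no gaps, so every vertex is within 2 (k -
  1) of the initial graph. Two such walks are joined by a short walk inside the initial
  graph.\<close>

lemma graph_diameter_le_depth:
  assumes \<omega>: "\<omega> \<in> space M" and k: "k \<notin> set (depths t \<omega>)"
  shows "graph_diameter (G t \<omega>) \<le> enat (4 * (k - 1) + (card (verts G0))\<^sup>2)"
proof (rule graph_diameter_le)
  let ?H = "G t \<omega>"
  have small: "h \<le> k - 1" if "h \<in> set (depths t \<omega>)" for h
  proof (rule ccontr)
    assume "\<not> h \<le> k - 1"
    then have "k \<in> {..h}" by auto
    then show False using downward_closed_depths[OF \<omega>] that k by (auto simp: downward_closed_def)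
  qed
  have initial_edges: "set (edges G0) \<subseteq> set (edges ?H)"
  proof (induction t)
    case (Suc t)
    then show ?case
      using step[of "Suc t", OF _ \<omega>] by (auto simp: gpa_step_def)
  qed (simp add: initial[OF \<omega>])
  have near: "\<exists>x\<in>verts G0. \<exists>j\<le>2 * (k - 1). walk ?H j v x" if v: "v \<in> verts ?H" for v
  proof (cases "v \<in> verts G0")
    case True
    then show ?thesis by (meson walk_0 le0)
  next
    case False
    then obtain e where "e \<in> set (edges ?H)" and e: "v \<in> set_uprod e"
      using vertex_initial_or_in_edge[OF \<omega> v] by blast
    then obtain i where i: "i < length (depths t \<omega>)" "edges ?H ! i = e"
      using length_depths[OF \<omega>, of t] by (metis in_set_conv_nth)
    obtain x j where x: "x \<in> verts G0" "j \<le> 2 * depths t \<omega> ! i" "walk ?H j v x"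
      using edges_withinD[OF edges_within_depths[OF \<omega>] i(1)] e i(2) by metis
    moreover have "2 * depths t \<omega> ! i \<le> 2 * (k - 1)"
      using small[OF nth_mem[OF i(1)]] by simp
    ultimately show ?thesis by (meson order_trans)
  qed
  fix v w assume "v \<in> verts ?H" "w \<in> verts ?H"
  then obtain x y i j where
    xy: "x \<in> verts G0" "y \<in> verts G0" and i: "i \<le> 2 * (k - 1)" "walk ?H i v x"
    and j: "j \<le> 2 * (k - 1)" "walk ?H j w y"
    using near by meson
  obtain d where d: "walk G0 d x y" "d \<le> (card (verts G0))\<^sup>2"
    using connected_short_walk[OF initial_wf initial_connected xy] .
  have "walk ?H (i + d + j) v w"
    using walk_trans[OF walk_trans[OF i(2) walk_mono[OF initial_edges d(1)]] walk_commute[OF j(2)]] .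
  moreover have "i + d + j \<le> 4 * (k - 1) + (card (verts G0))\<^sup>2"
    using i(1) j(1) d(2) by linarith
  ultimately show "\<exists>n\<le>4 * (k - 1) + (card (verts G0))\<^sup>2. walk ?H n v w"
    by blast
qed

section \<open>Histories and measurability\<close>

definition history :: "nat \<Rightarrow> 'w \<Rightarrow> nat mgraph list \<times> (nat option \<times> nat list) list \<times> (nat \<times> nat) list" where
  "history t \<omega> = (map (\<lambda>r. G r \<omega>) [0..<t], map (\<lambda>r. S r \<omega>) [1..<t],
     map (\<lambda>r. (A r \<omega>, B r \<omega>)) [1..<Suc t])"

text \<open>The right-hand side is the predicate \<open>past\<close> of the assumption
  \<open>uniform\<close>. Hence the atoms of \<open>history t\<close> are exactly the events on
  which the law of the sample at time t is prescribed.\<close>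

lemma history_eq_iff:
  "history t \<omega>' = history t \<omega> \<longleftrightarrow> (\<forall>r<t. G r \<omega>' = G r \<omega>) \<and> (\<forall>r\<in>{1..<t}. S r \<omega>' = S r \<omega>) \<and>
     (\<forall>r\<in>{1..t}. A r \<omega>' = A r \<omega> \<and> B r \<omega>' = B r \<omega>)"
  unfolding history_def by (auto simp: map_eq_conv simp del: upt_Suc)

lemma countable_range_history: "countable (history t ` space M)"
proof (rule countable_subset)
  show "history t ` space M \<subseteq> lists {H. finite (verts H)} \<times> UNIV \<times> UNIV"
    by (auto simp: history_def finite_verts)
  show "countable (lists {H :: nat mgraph. finite (verts H)} \<times> (UNIV :: (nat option \<times> nat list) list set)
      \<times> (UNIV :: (nat \<times> nat) list set))"
    by (intro countable_SIGMA countable_lists countable_finite_mgraphs countableI_type)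
qed

lemma sets_history: "{\<omega>' \<in> space M. history t \<omega>' = history t \<omega>} \<in> sets M"
proof -
  note measurable_G[measurable]
  have [measurable]: "r \<in> {1..<t} \<Longrightarrow> Measurable.pred M (\<lambda>\<omega>'. S r \<omega>' = S r \<omega>)" for r
    using measurable_S[of r] by simp
  have [measurable]: "r \<in> {1..t} \<Longrightarrow> Measurable.pred M (\<lambda>\<omega>'. A r \<omega>' = A r \<omega>)" for r
    using measurable_A[of r] by simp
  have [measurable]: "r \<in> {1..t} \<Longrightarrow> Measurable.pred M (\<lambda>\<omega>'. B r \<omega>' = B r \<omega>)" for r
    using measurable_B[of r] by simp
  have "Measurable.pred M (\<lambda>\<omega>'. (\<forall>r\<in>{..<t}. G r \<omega>' = G r \<omega>) \<and> (\<forall>r\<in>{1..<t}. S r \<omega>' = S r \<omega>) \<and>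
     (\<forall>r\<in>{1..t}. A r \<omega>' = A r \<omega> \<and> B r \<omega>' = B r \<omega>))"
    by measurable
  then show ?thesis
    unfolding history_eq_iff pred_def by (simp add: Ball_def)
qed

lemma sets_Collect_G: "{\<omega> \<in> space M. P (G t \<omega>)} \<in> sets M"
proof -
  have "G t -` Collect P \<inter> space M \<in> sets M"
    by (rule measurable_sets[OF measurable_G]) simp
  also have "G t -` Collect P \<inter> space M = {\<omega> \<in> space M. P (G t \<omega>)}" by auto
  finally show ?thesis .
qed

lemma depths_cong:
  assumes "\<And>r. r \<in> {1..t} \<Longrightarrow> S r \<omega> = S r \<omega>'" "\<And>r. r \<in> {1..t} \<Longrightarrow> A r \<omega> = A r \<omega>'"
  shows "depths t \<omega> = depths t \<omega>'"
  using assms by (induction t) auto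

lemma measurable_depths [measurable]: "depths t \<in> measurable M (count_space UNIV)"
proof (induction t)
  case 0
  then show ?case by simp
next
  case (Suc t)
  have "(\<lambda>\<omega>. depth_step (depths t \<omega>) (A (Suc t) \<omega>) (S (Suc t) \<omega>)) \<in> measurable M (count_space UNIV)"
    \<comment> \<open>All three arguments of \<open>depth_step\<close> have countable types, so they
      can be frozen to constants one after the other.\<close>
    using measurable_compose_countable[of "\<lambda>hs \<omega>. depth_step hs (A (Suc t) \<omega>) (S (Suc t) \<omega>)", OF
        measurable_compose_countable[of "\<lambda>a \<omega>. depth_step _ a (S (Suc t) \<omega>)", OF
          measurable_compose_countable[of "\<lambda>s \<omega>. depth_step _ _ s", OF
            measurable_const measurable_S] measurable_A] Suc]
    by simp
  then show ?case by simp
qed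

text \<open>On an atom of \<open>history (Suc t)\<close> the old depths and the values of A and B at
  time t + 1 are fixed and only the sample is random. Averaging over it multiplies the number of
  edges of depth k by (a + b) / m, which is at most the stated factor, since a + b <= u and at least
  l edges are added per step.\<close>

lemma nn_integral_count_depths_Suc_le:
  assumes bounds: "\<And>r \<omega>. r \<ge> 1 \<Longrightarrow> \<omega> \<in> space M \<Longrightarrow> l \<le> A r \<omega> + B r \<omega> \<and> A r \<omega> + B r \<omega> \<le> u"
  shows "(\<integral>\<^sup>+\<omega>. ennreal (count_list (depths (Suc t) \<omega>) (Suc k)) \<partial>M)
    \<le> (\<integral>\<^sup>+\<omega>. ennreal (count_list (depths t \<omega>) (Suc k)) \<partial>M)
      + ennreal (real u / (real (length (edges G0)) + real l * real t)) * (\<integral>\<^sup>+\<omega>. ennreal (count_list (depths t \<omega>) k) \<partial>M)"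
proof -
  define p where "p = real u / (real (length (edges G0)) + real l * real t)"
  have p: "p \<ge> 0" by (simp add: p_def)
  have "(\<integral>\<^sup>+\<omega>. ennreal (count_list (depths (Suc t) \<omega>) (Suc k)) \<partial>M)
    \<le> (\<integral>\<^sup>+\<omega>. ennreal (count_list (depths t \<omega>) (Suc k) + p * count_list (depths t \<omega>) k) \<partial>M)"
  proof (rule nn_integral_mono_atoms[where Y = "history (Suc t)"])
    show "countable (history (Suc t) ` space M)" by (rule countable_range_history)
    show "{\<omega>' \<in> space M. history (Suc t) \<omega>' = history (Suc t) \<omega>} \<in> sets M" for \<omega>
      by (rule sets_history)
    show "(\<lambda>\<omega>. ennreal (count_list (depths (Suc t) \<omega>) (Suc k))) \<in> borel_measurable M"
      "(\<lambda>\<omega>. ennreal (count_list (depths t \<omega>) (Suc k) + p * count_list (depths t \<omega>) k)) \<in> borel_measurable M"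
      by (rule measurable_compose[OF measurable_depths]; simp)+
    fix \<omega> assume \<omega>: "\<omega> \<in> space M"
    define P where "P = {\<omega>' \<in> space M. history (Suc t) \<omega>' = history (Suc t) \<omega>}"
    have [measurable]: "P \<in> sets M" unfolding P_def by (rule sets_history)
    define hs where "hs = depths t \<omega>"
    define m where "m = length hs"
    define a where "a = A (Suc t) \<omega>"
    define b where "b = B (Suc t) \<omega>"
    define SS where "SS = sample_space m a b"
    have m_ge: "real (length (edges G0)) + real l * real t \<le> real m"
      using length_depths_ge[OF \<omega>, of l t] bounds[OF _ \<omega>] unfolding m_def hs_def
      by (simp flip: of_nat_mult of_nat_add)
    have G0_pos: "length (edges G0) > 0" using initial_edge by simp
    moreover have "real l * real t \<ge> 0" by simp
    ultimately have "m > 0" using m_ge by linarith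
    have "real (a + b) / real m \<le> p"
      unfolding p_def using bounds[of "Suc t", OF _ \<omega>] m_ge G0_pos
      by (intro frac_le) (auto simp: a_def b_def add_pos_nonneg)
    then have mean_le: "real (count_list hs (Suc k)) + real (a + b) / real m * real (count_list hs k)
        \<le> real (count_list hs (Suc k)) + p * real (count_list hs k)"
      by (intro add_left_mono mult_right_mono) auto
    have SS_eq: "SS = sample_space (length (edges (G (Suc t - 1) \<omega>))) (A (Suc t) \<omega>) (B (Suc t) \<omega>)"
      by (simp add: SS_def m_def hs_def a_def b_def length_depths[OF \<omega>])
    \<comment> \<open>Depths are determined by the earlier samples and values of A, all recorded in
      the history, so they are constant on the atom.\<close>
    have on_P: "depths t \<omega>' = hs" "A (Suc t) \<omega>' = a" "S (Suc t) \<omega>' \<in> SS" if "\<omega>' \<in> P" for \<omega>'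
    proof -
      have hist: "(\<forall>r<Suc t. G r \<omega>' = G r \<omega>) \<and> (\<forall>r\<in>{1..<Suc t}. S r \<omega>' = S r \<omega>) \<and>
         (\<forall>r\<in>{1..Suc t}. A r \<omega>' = A r \<omega> \<and> B r \<omega>' = B r \<omega>)" and "\<omega>' \<in> space M"
        using that unfolding P_def history_eq_iff by auto
      then show "depths t \<omega>' = hs" "A (Suc t) \<omega>' = a"
        unfolding hs_def a_def by (auto intro!: depths_cong)
      show "S (Suc t) \<omega>' \<in> SS"
        using sample[of "Suc t", OF _ \<open>\<omega>' \<in> space M\<close>] hist unfolding SS_eq by simp
    qed
    define \<phi> where "\<phi> s = real (count_list (depth_step hs a s) (Suc k))" for s
    define Q where "Q s = {\<omega>' \<in> space M. S (Suc t) \<omega>' = s \<and> history (Suc t) \<omega>' = history (Suc t) \<omega>}" for s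
    have Q_alt: "Q s = P \<inter> {\<omega>' \<in> space M. S (Suc t) \<omega>' = s}" for s
      by (auto simp: Q_def P_def)
    have [measurable]: "S (Suc t) \<in> measurable M (count_space UNIV)" by (rule measurable_S) simp
    have Q [measurable]: "Q s \<in> sets M" for s
      unfolding Q_alt by measurable
    have finSS: "finite SS" unfolding SS_def by (rule finite_sample_space)
    have "S (Suc t) \<omega> \<in> SS"
      using sample[of "Suc t", OF _ \<omega>] unfolding SS_eq by simp
    then have card_SS: "card SS > 0" using finSS card_gt_0_iff by blast
    \<comment> \<open>The assumption \<open>uniform\<close> covers only atoms of positive
      probability. On a null atom both sides vanish.\<close>
    have prob_Q: "prob (Q s) = prob P / card SS" if "s \<in> SS" for s
    proof (cases "prob P > 0")
      case True
      have "cond_prob M (\<lambda>\<omega>'. S (Suc t) \<omega>' = s) (\<lambda>\<omega>'. history (Suc t) \<omega>' = history (Suc t) \<omega>) = 1 / card SS"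
        unfolding SS_eq
        using True that
        by (intro uniform) (auto simp: history_eq_iff fun_eq_iff P_def SS_eq \<omega>)
      then show ?thesis
        using True by (simp add: cond_prob_def Q_def P_def field_simps)
    next
      case False
      then have "prob P = 0" using measure_nonneg[of M P] by linarith
      moreover have "prob (Q s) \<le> prob P"
        by (rule finite_measure_mono) (auto simp: Q_alt)
      ultimately show ?thesis using measure_nonneg[of M "Q s"] by simp
    qed
    \<comment> \<open>The atom is the disjoint union of the sets \<open>Q s\<close>, and the
      integrand is the constant \<open>\<phi> s\<close> on each of them.\<close>
    have "(\<integral>\<^sup>+\<omega>'. ennreal (count_list (depths (Suc t) \<omega>') (Suc k)) * indicator P \<omega>' \<partial>M)
      = (\<integral>\<^sup>+\<omega>'. (\<Sum>s\<in>SS. ennreal (\<phi> s) * indicator (Q s) \<omega>') \<partial>M)"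
    proof (rule nn_integral_cong)
      fix \<omega>' assume "\<omega>' \<in> space M"
      show "ennreal (count_list (depths (Suc t) \<omega>') (Suc k)) * indicator P \<omega>'
        = (\<Sum>s\<in>SS. ennreal (\<phi> s) * indicator (Q s) \<omega>')"
      proof (cases "\<omega>' \<in> P")
        case True
        then have "(\<Sum>s\<in>SS. ennreal (\<phi> s) * indicator (Q s) \<omega>')
          = (\<Sum>s\<in>SS. if s = S (Suc t) \<omega>' then ennreal (\<phi> s) else 0)"
          using \<open>\<omega>' \<in> space M\<close> by (intro sum.cong refl) (auto simp: Q_alt)
        also have "\<dots> = ennreal (\<phi> (S (Suc t) \<omega>'))"
          using finSS on_P(3)[OF True] by simp
        finally show ?thesis using True on_P[OF True] by (simp add: \<phi>_def)
      qed (auto simp: Q_alt)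
    qed
    also have "\<dots> = (\<Sum>s\<in>SS. ennreal (\<phi> s) * emeasure M (Q s))"
      by (subst nn_integral_sum) (auto simp: nn_integral_cmult_indicator)
    also have "\<dots> = (\<Sum>s\<in>SS. ennreal (\<phi> s * (prob P / card SS)))"
      by (intro sum.cong refl) (subst ennreal_mult', auto simp: emeasure_eq_measure prob_Q \<phi>_def)
    also have "\<dots> = ennreal ((\<Sum>s\<in>SS. \<phi> s) * (prob P / card SS))"
      by (subst sum_ennreal) (auto simp: \<phi>_def sum_distrib_right sum_divide_distrib)
    also have "\<dots> = ennreal ((real (count_list hs (Suc k)) + real (a + b) / real m * real (count_list hs k)) * prob P)"
      using sum_count_list_depth_step[of hs a k b] \<open>m > 0\<close> card_SS unfolding \<phi>_def SS_def m_def by simp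
    also have "\<dots> \<le> ennreal ((real (count_list hs (Suc k)) + p * real (count_list hs k)) * prob P)"
      using mean_le by (intro ennreal_leI mult_right_mono) auto
    also have "\<dots> = (\<integral>\<^sup>+\<omega>'. ennreal (real (count_list hs (Suc k)) + p * real (count_list hs k)) * indicator P \<omega>' \<partial>M)"
      using p by (simp add: nn_integral_cmult_indicator emeasure_eq_measure ennreal_mult')
    also have "\<dots> = (\<integral>\<^sup>+\<omega>'. ennreal (count_list (depths t \<omega>') (Suc k) + p * count_list (depths t \<omega>') k) * indicator P \<omega>' \<partial>M)"
      using on_P(1) by (intro nn_integral_cong) (auto split: split_indicator)
    finally show "(\<integral>\<^sup>+\<omega>'. ennreal (count_list (depths (Suc t) \<omega>') (Suc k))
          * indicator {\<omega>' \<in> space M. history (Suc t) \<omega>' = history (Suc t) \<omega>} \<omega>' \<partial>M)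
      \<le> (\<integral>\<^sup>+\<omega>'. ennreal (count_list (depths t \<omega>') (Suc k) + p * count_list (depths t \<omega>') k)
          * indicator {\<omega>' \<in> space M. history (Suc t) \<omega>' = history (Suc t) \<omega>} \<omega>' \<partial>M)"
      unfolding P_def .
  qed
  also have "\<dots> = (\<integral>\<^sup>+\<omega>. ennreal (count_list (depths t \<omega>) (Suc k)) + ennreal p * ennreal (count_list (depths t \<omega>) k) \<partial>M)"
    using p by (intro nn_integral_cong) (simp add: ennreal_plus ennreal_mult')
  also have "\<dots> = (\<integral>\<^sup>+\<omega>. ennreal (count_list (depths t \<omega>) (Suc k)) \<partial>M)
      + ennreal p * (\<integral>\<^sup>+\<omega>. ennreal (count_list (depths t \<omega>) k) \<partial>M)"
  proof -
    have [measurable]: "(\<lambda>\<omega>. ennreal (count_list (depths t \<omega>) j)) \<in> borel_measurable M" for j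
      by (rule measurable_compose[OF measurable_depths]) simp
    show ?thesis by (simp add: nn_integral_add nn_integral_cmult)
  qed
  finally show ?thesis unfolding p_def .
qed

text \<open>Induction on t for all k at once: the one-step recursion raises the partial sum s by its
  next term, and \<open>power_over_fact_add\<close> absorbs the contribution of depth k - 1. Depth 0
  is special, as its count never changes.\<close>

lemma nn_integral_count_depths_le:
  assumes bounds: "\<And>r \<omega>. r \<ge> 1 \<Longrightarrow> \<omega> \<in> space M \<Longrightarrow> l \<le> A r \<omega> + B r \<omega> \<and> A r \<omega> + B r \<omega> \<le> u"
  defines "m \<equiv> real (length (edges G0))"
  shows "(\<integral>\<^sup>+\<omega>. ennreal (count_list (depths t \<omega>) k) \<partial>M)
    \<le> ennreal (m * ((\<Sum>i<t. real u / (m + real l * real i)) ^ k / fact k))"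
proof (induction t arbitrary: k)
  case 0
  have "count_list (replicate n (0 :: nat)) k = (if k = 0 then n else 0)" for n
    by (induction n) auto
  \<comment> \<open>For the empty sum the bound is m 0^k / k!, which with 0^0 = 1 is exactly the
    initial count.\<close>
  then show ?case by (simp add: m_def emeasure_space_1 power_0_left)
next
  case (Suc t)
  define s where "s = (\<Sum>i<t. real u / (m + real l * real i))"
  define p where "p = real u / (m + real l * real t)"
  have m: "m \<ge> 0" and s: "s \<ge> 0" and p: "p \<ge> 0"
    by (auto simp: m_def s_def p_def intro!: sum_nonneg)
  show ?case
  proof (cases k)
    case 0
    then show ?thesis using Suc.IH[of 0] by (simp add: count_list_depth_step_0)
  next
    case k: (Suc j)
    have "(\<integral>\<^sup>+\<omega>. ennreal (count_list (depths (Suc t) \<omega>) k) \<partial>M)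
      \<le> ennreal (m * (s ^ Suc j / fact (Suc j))) + ennreal p * ennreal (m * (s ^ j / fact j))"
      unfolding k s_def p_def
      by (intro order_trans[OF nn_integral_count_depths_Suc_le[OF bounds, folded m_def]]
          add_mono mult_left_mono Suc.IH) auto
    also have "\<dots> = ennreal (m * (s ^ Suc j / fact (Suc j) + p * (s ^ j / fact j)))"
      using m s p by (simp add: ennreal_plus[symmetric] ennreal_mult'[symmetric] algebra_simps del: ennreal_plus fact_Suc power_Suc)
    also have "\<dots> \<le> ennreal (m * ((s + p) ^ Suc j / fact (Suc j)))"
      using m power_over_fact_add[OF s p] by (intro ennreal_leI mult_left_mono)
    finally show ?thesis by (simp add: k s_def p_def)
  qed
qed

section \<open>Tail bounds for the depths and the diameter\<close>

lemma prob_depth_le: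
  assumes bounds: "\<And>r \<omega>. r \<ge> 1 \<Longrightarrow> \<omega> \<in> space M \<Longrightarrow> l \<le> A r \<omega> + B r \<omega> \<and> A r \<omega> + B r \<omega> \<le> u"
    and "l > 0" "t > 0" "exp 1 * (real u * (2 + ln t / l)) \<le> real k"
  shows "prob {\<omega> \<in> space M. k \<in> set (depths t \<omega>)} \<le> length (edges G0) * exp (- (ln k / 4))"
proof -
  define m where "m = real (length (edges G0))"
  define s where "s = (\<Sum>i<t. real u / (m + real l * real i))"
  define a where "a = real u * (2 + ln t / l)"
  have m: "m > 0" using initial_edge by (simp add: m_def)
  obtain \<omega> where "\<omega> \<in> space M" using not_empty by blast
  then have u: "u > 0" using bounds[of 1 \<omega>] \<open>l > 0\<close> by simp
  have a: "a > 0"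
    unfolding a_def using u assms(2,3) by (intro mult_pos_pos add_pos_nonneg) auto
  have s: "0 \<le> s" unfolding s_def using m by (intro sum_nonneg) auto
  have "s = real u * (\<Sum>i<t. 1 / (m + real l * real i))"
    by (simp add: s_def sum_distrib_left)
  also have "\<dots> \<le> a"
    unfolding a_def m_def using assms(2,3) initial_edge
    by (intro mult_left_mono sum_inverse_arith_progression_le) auto
  finally have "s ^ k / fact k \<le> a ^ k / fact k"
    using s by (intro divide_right_mono power_mono) auto
  also have "\<dots> \<le> exp (- (ln k / 4))"
    using a assms(4) unfolding a_def by (intro power_over_fact_le)
  finally have s_le: "m * (s ^ k / fact k) \<le> m * exp (- (ln k / 4))"
    using m by (intro mult_left_mono) auto
  have [measurable]: "Measurable.pred M (\<lambda>\<omega>. k \<in> set (depths t \<omega>))"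
    by (rule measurable_compose[OF measurable_depths]) simp
  \<comment> \<open>First-moment method: the probability that depth k occurs is at most the expected
    number of edges of depth k.\<close>
  have "emeasure M {\<omega> \<in> space M. k \<in> set (depths t \<omega>)}
      = (\<integral>\<^sup>+\<omega>. indicator {\<omega> \<in> space M. k \<in> set (depths t \<omega>)} \<omega> \<partial>M)"
    by simp
  also have "\<dots> \<le> (\<integral>\<^sup>+\<omega>. ennreal (count_list (depths t \<omega>) k) \<partial>M)"
  proof (rule nn_integral_mono)
    fix \<omega>
    have "1 \<le> real (count_list (depths t \<omega>) k)" if "k \<in> set (depths t \<omega>)"
      using that count_list_0_iff[of "depths t \<omega>" k] by simp
    then show "indicator {\<omega> \<in> space M. k \<in> set (depths t \<omega>)} \<omega> \<le> ennreal (count_list (depths t \<omega>) k)"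
      by (auto split: split_indicator)
  qed
  also have "\<dots> \<le> ennreal (m * (s ^ k / fact k))"
    unfolding m_def s_def by (rule nn_integral_count_depths_le[OF bounds])
  also have "\<dots> \<le> ennreal (m * exp (- (ln k / 4)))"
    using s_le by (rule ennreal_leI)
  finally show ?thesis
    using m by (simp add: emeasure_eq_measure m_def)
qed

text \<open>Take k to be x = e u (2 + ln t / l) rounded up; the bound on the diameter is then 4 x
  plus a constant. Since u >= l gives k >= ln t, the failure probability is at most m (ln t)^(-1/4),
  where m is the initial number of edges, uniformly in l and u.\<close>

lemma prob_graph_diameter_bound:
  assumes bounds: "\<And>r \<omega>. r \<ge> 1 \<Longrightarrow> \<omega> \<in> space M \<Longrightarrow> l \<le> A r \<omega> + B r \<omega> \<and> A r \<omega> + B r \<omega> \<le> u"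
    and l: "l > 0" and t: "t > 1"
  shows "1 - length (edges G0) * exp (- (ln (ln t) / 4))
    \<le> prob {\<omega> \<in> space M. ereal_of_enat (graph_diameter (G t \<omega>)) \<le>
        ereal (4 * exp 1 * (real u / real l) * ln t + 8 * exp 1 * real u + real ((card (verts G0))\<^sup>2))}"
    (is "_ \<le> prob ?good")
proof -
  define e where "e = exp (1 :: real)"
  define x where "x = e * (real u * (2 + ln t / l))"
  define k where "k = nat \<lceil>x\<rceil>"
  obtain \<omega> where "\<omega> \<in> space M" using not_empty by blast
  then have u: "u \<ge> l" using bounds[of 1 \<omega>] by simp
  have ln: "ln t > 0" using t by simp
  have "ln t \<le> real u / real l * ln t"
    using ln u l mult_right_mono[of 1 "real u / real l" "ln t"] by simp
  also have "\<dots> \<le> real u * (2 + ln t / l)"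
    by (simp add: algebra_simps)
  also have "\<dots> \<le> x"
    unfolding x_def e_def using ln
    by (intro order_trans[OF _ mult_right_mono[of 1 "exp 1"]]) (auto simp: mult_nonneg_nonneg add_nonneg_nonneg)
  finally have ln_le: "ln t \<le> x" .
  then have x: "x > 0" using ln by linarith
  have k_ge: "x \<le> real k" and k_le: "real k < x + 1"
    unfolding k_def using x by linarith+
  have "k > 0" using k_ge x by (cases k) auto
  have [measurable]: "Measurable.pred M (\<lambda>\<omega>. k \<in> set (depths t \<omega>))"
    by (rule measurable_compose[OF measurable_depths]) simp
  have good [measurable]: "?good \<in> sets M"
    by (rule sets_Collect_G)
  have "exp (- (ln k / 4)) \<le> exp (- (ln (ln t) / 4))"
    using ln ln_le k_ge by simp
  then have "1 - length (edges G0) * exp (- (ln (ln t) / 4)) \<le> 1 - length (edges G0) * exp (- (ln k / 4))"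
    by (intro diff_left_mono mult_left_mono) auto
  also have "\<dots> \<le> 1 - prob {\<omega> \<in> space M. k \<in> set (depths t \<omega>)}"
    using k_ge t unfolding x_def e_def by (intro diff_left_mono prob_depth_le[OF bounds l]) auto
  also have "\<dots> = prob {\<omega> \<in> space M. k \<notin> set (depths t \<omega>)}"
    by (rule prob_neg[symmetric]) measurable
  also have "\<dots> \<le> prob ?good"
  proof (rule finite_measure_mono[OF _ good], safe)
    fix \<omega> assume \<omega>: "\<omega> \<in> space M" "k \<notin> set (depths t \<omega>)"
    have "ereal_of_enat (graph_diameter (G t \<omega>)) \<le> ereal_of_enat (enat (4 * (k - 1) + (card (verts G0))\<^sup>2))"
      using graph_diameter_le_depth[OF \<omega>] by (subst ereal_of_enat_le_iff)
    also have "\<dots> = ereal (4 * (real k - 1) + real ((card (verts G0))\<^sup>2))"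
      using \<open>k > 0\<close> by (simp add: of_nat_diff)
    \<comment> \<open>Since k - 1 < x, rounding up costs nothing.\<close>
    also have "\<dots> \<le> ereal (4 * x + real ((card (verts G0))\<^sup>2))"
      using k_le by simp
    also have "4 * x = 4 * exp 1 * (real u / real l) * ln t + 8 * exp 1 * real u"
      by (simp add: x_def e_def algebra_simps)
    finally show "ereal_of_enat (graph_diameter (G t \<omega>)) \<le>
        ereal (4 * exp 1 * (real u / real l) * ln t + 8 * exp 1 * real u + real ((card (verts G0))\<^sup>2))" .
  qed
  finally show ?thesis .
qed

end

section \<open>The limit along a sequence of models\<close>

theorem theorem3p1:
  fixes M :: "nat \<Rightarrow> 'w measure"
    and G0 :: "nat \<Rightarrow> nat mgraph"
    and G :: "nat \<Rightarrow> nat \<Rightarrow> 'w \<Rightarrow> nat mgraph"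
    and A B :: "nat \<Rightarrow> nat \<Rightarrow> 'w \<Rightarrow> nat"
    and S :: "nat \<Rightarrow> nat \<Rightarrow> 'w \<Rightarrow> nat option \<times> nat list"
    and l u :: "nat \<Rightarrow> nat"
    and c :: nat
  assumes process: "\<And>n. generic_preferential_attachment (M n) (G0 n) (G n) (A n) (B n) (S n)"
    and initial_size: "\<And>n. card (verts (G0 n)) + length (edges (G0 n)) \<le> c"
    and pos: "\<And>n. l n > 0" "\<And>n. u n > 0"
    and bounds: "\<And>n t \<omega>. t \<ge> 1 \<Longrightarrow> \<omega> \<in> space (M n) \<Longrightarrow>
      l n \<le> A n t \<omega> + B n t \<omega> \<and> A n t \<omega> + B n t \<omega> \<le> u n"
  shows "\<exists>K::real. (\<lambda>n. measure (M n) {\<omega> \<in> space (M n).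
      ereal_of_enat (graph_diameter (G n n \<omega>)) \<le>
        ereal (4 * exp 1 * (real (u n) / real (l n)) * ln (real n) + 8 * exp 1 * real (u n) + K)})
      \<longlonglongrightarrow> 1"
proof
  define bound where "bound n K = ereal (4 * exp 1 * (real (u n) / real (l n)) * ln (real n)
    + 8 * exp 1 * real (u n) + real K)" for n and K :: nat
  define good where "good n K = {\<omega> \<in> space (M n). ereal_of_enat (graph_diameter (G n n \<omega>)) \<le> bound n K}" for n K
  \<comment> \<open>The witness for \<open>K\<close> is the square of \<open>c\<close>: it dominates
    the squared number of initial vertices for every n at once. Likewise \<open>c\<close> replaces
    the initial number of edges in the failure probability, so one null sequence serves all the
    models.\<close>
  have le_1: "measure (M n) (good n (c\<^sup>2)) \<le> 1" for n
  proof -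
    interpret generic_preferential_attachment "M n" "G0 n" "G n" "A n" "B n" "S n" by (rule process)
    show ?thesis by (rule prob_le_1)
  qed
  have ge: "1 - real c * exp (- (ln (ln (real n)) / 4)) \<le> measure (M n) (good n (c\<^sup>2))" if "n > 1" for n
  proof -
    interpret generic_preferential_attachment "M n" "G0 n" "G n" "A n" "B n" "S n" by (rule process)
    have c: "card (verts (G0 n)) \<le> c" "length (edges (G0 n)) \<le> c"
      using initial_size[of n] by auto
    have "1 - real c * exp (- (ln (ln (real n)) / 4)) \<le> 1 - length (edges (G0 n)) * exp (- (ln (ln (real n)) / 4))"
      using c(2) by (intro diff_left_mono mult_right_mono) auto
    also have "\<dots> \<le> measure (M n) (good n ((card (verts (G0 n)))\<^sup>2))"
      using prob_graph_diameter_bound[OF bounds pos(1) that] unfolding good_def bound_def by simp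
    also have "\<dots> \<le> measure (M n) (good n (c\<^sup>2))"
    proof (rule finite_measure_mono)
      have "bound n ((card (verts (G0 n)))\<^sup>2) \<le> bound n (c\<^sup>2)"
        using c(1) unfolding bound_def by (simp add: power_mono)
      then show "good n ((card (verts (G0 n)))\<^sup>2) \<subseteq> good n (c\<^sup>2)"
        unfolding good_def by (blast intro: order_trans)
      show "good n (c\<^sup>2) \<in> sets (M n)"
        unfolding good_def by (rule sets_Collect_G)
    qed
    finally show ?thesis .
  qed
  have "(\<lambda>n. measure (M n) (good n (c\<^sup>2))) \<longlonglongrightarrow> 1"
  proof (rule tendsto_sandwich)
    show "(\<lambda>n. 1 - real c * exp (- (ln (ln (real n)) / 4))) \<longlonglongrightarrow> 1"
      by real_asymp
    show "eventually (\<lambda>n. 1 - real c * exp (- (ln (ln (real n)) / 4)) \<le> measure (M n) (good n (c\<^sup>2))) sequentially"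
      using eventually_gt_at_top[of 1] by eventually_elim (rule ge)
    show "eventually (\<lambda>n. measure (M n) (good n (c\<^sup>2)) \<le> 1) sequentially"
      using le_1 by simp
  qed simp
  then show "(\<lambda>n. measure (M n) {\<omega> \<in> space (M n).
      ereal_of_enat (graph_diameter (G n n \<omega>)) \<le>
        ereal (4 * exp 1 * (real (u n) / real (l n)) * ln (real n) + 8 * exp 1 * real (u n) + real (c\<^sup>2))})
      \<longlonglongrightarrow> 1"
    unfolding good_def bound_def .
qed

end
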